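(* Assume $\alpha>1$. Fix integers $n_{I_1}\geq n_{I_2}\ge1$ with $n_{I_1}+n_{I_2}=n_I$. Let $g\mapsto (x_E(g),x_{I_1}(g),x_{I_2}(g))$, $g>g_0:=\frac{\sqrt N}{\alpha\mu_{EE}}$, be an $I_1/I_2$ branch of equilibria, and let $\mathbf x^*(g) = (x_E,x_{I_1},\dots,x_{I_1},x_{I_2},\dots,x_{I_2})^T\in\mathbb R^{1+n_I}$ ($x_{I_1}$ and $x_{I_2}$ repeated $n_{I_1}$ and $n_{I_2}$ times) be the corresponding fixed points of $\dot{\mathbf x}=\tilde F(\mathbf x,g):=-\mathbf x+\frac1{\sqrt N}\tilde H\tanh(g\mathbf x)$. Then for all sufficiently large $g$ the fixed point $\mathbf x^*(g)$ is unstable: the Jacobian $D\tilde F(\mathbf x^*(g))$ has an eigenvalue with positive real part.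
   Context: Let $n_E,n_I\ge 1$ be integers, $N=n_E+n_I$, $f=n_E/N$, $\alpha=\frac{f}{1-f}$ (so $n_E=\alpha n_I$), $\mu_{EE}>0$. The function $\tanh$ acts on vectors componentwise. $\mathbf 1_{m\times n}$ is the all-ones matrix and $\mathbf K_n=\mathbf 1_{n\times n}-\mathbf I_n$, with $\mathbf I_n$ the identity. The matrix $\tilde H$ (one excitatory cluster whose synchronized activity is a single variable $x_E$, and $n_I$ inhibitory cells, balanced weights) is $$\tilde H=\begin{bmatrix}(n_E-1)\mu_{EE} & -\alpha\mu_{EE}\mathbf 1_{1\times n_I}\\ n_E\mu_{EE}\mathbf 1_{n_I\times1} & -\alpha\mu_{EE}\mathbf K_{n_I}\end{bmatrix}.$$ The Jacobian is $D\tilde F(\mathbf x^* )=\frac{g}{\sqrt N}\tilde H\,\mathrm{diag}(\operatorname{sech}^2(g\mathbf x^* ))-\mathbf I_{1+n_I}$. An $I_1/I_2$ branch is a continuous family, parametrized by $g>g_0$, of equilibria of this system in which the inhibitory cells are divided into two synchronized clusters of sizes $n_{I_1}$ and $n_{I_2}$ with activities $x_{I_1}(g)\ne x_{I_2}(g)$, and which emanates from the origin at $g=g_0$ (i.e. $(x_E,x_{I_1},x_{I_2})\to(0,0,0)$ as $g\to g_0^+$). Along such a branch $x_{I_1}$ and $x_{I_2}$ are nonzero and have opposite signs for all $g>g_0$. *)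

theory Defs
  imports Complex_Main "Jordan_Normal_Form.Char_Poly"
begin

definition exc_fraction :: "nat \<Rightarrow> nat \<Rightarrow> real" where
  "exc_fraction nE nI = real nE / real (nE + nI)"

definition balance :: "nat \<Rightarrow> nat \<Rightarrow> real" where
  "balance nE nI = exc_fraction nE nI / (1 - exc_fraction nE nI)"

definition ones_mat :: "nat \<Rightarrow> nat \<Rightarrow> real mat" where
  "ones_mat m n = mat m n (\<lambda>_. 1)"

definition K_mat :: "nat \<Rightarrow> real mat" where
  "K_mat n = ones_mat n n - 1\<^sub>m n"

definition H_tilde :: "real \<Rightarrow> nat \<Rightarrow> nat \<Rightarrow> real mat" where
  "H_tilde \<mu> nE nI = four_block_mat
     (((real nE - 1) * \<mu>) \<cdot>\<^sub>m ones_mat 1 1)   ((- balance nE nI * \<mu>) \<cdot>\<^sub>m ones_mat 1 nI)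
     ((real nE * \<mu>) \<cdot>\<^sub>m ones_mat nI 1)         ((- balance nE nI * \<mu>) \<cdot>\<^sub>m K_mat nI)"

definition F_tilde :: "real \<Rightarrow> nat \<Rightarrow> nat \<Rightarrow> real vec \<Rightarrow> real \<Rightarrow> real vec" where
  "F_tilde \<mu> nE nI x g =
     - x + (1 / sqrt (real (nE + nI))) \<cdot>\<^sub>v (H_tilde \<mu> nE nI *\<^sub>v map_vec tanh (g \<cdot>\<^sub>v x))"

definition sech :: "real \<Rightarrow> real" where
  "sech y = 1 / cosh y"

definition DF_tilde :: "real \<Rightarrow> nat \<Rightarrow> nat \<Rightarrow> real vec \<Rightarrow> real \<Rightarrow> real mat" where
  "DF_tilde \<mu> nE nI x g =
     (g / sqrt (real (nE + nI))) \<cdot>\<^sub>m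
       (H_tilde \<mu> nE nI * mat_diag (1 + nI) (\<lambda>i. (sech (g * x $ i))\<^sup>2)) - 1\<^sub>m (1 + nI)"

definition cluster_state :: "nat \<Rightarrow> nat \<Rightarrow> real \<Rightarrow> real \<Rightarrow> real \<Rightarrow> real vec" where
  "cluster_state nI1 nI2 xE xI1 xI2 =
     vec_of_list (xE # replicate nI1 xI1 @ replicate nI2 xI2)"

definition g_crit :: "real \<Rightarrow> nat \<Rightarrow> nat \<Rightarrow> real" where
  "g_crit \<mu> nE nI = sqrt (real (nE + nI)) / (balance nE nI * \<mu>)"

text \<open>That the two inhibitory activities are nonzero with opposite signs is not part of the
  definition of a branch: it follows from the equilibrium equations, see
  \<open>I1_I2_branch_opposite_signs\<close> below.\<close>

definition I1_I2_branch ::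
  "real \<Rightarrow> nat \<Rightarrow> nat \<Rightarrow> nat \<Rightarrow> real \<Rightarrow> (real \<Rightarrow> real) \<Rightarrow> (real \<Rightarrow> real) \<Rightarrow> (real \<Rightarrow> real) \<Rightarrow> bool" where
  "I1_I2_branch \<mu> nE nI1 nI2 g0 xE xI1 xI2 \<longleftrightarrow>
     continuous_on {g0<..} xE \<and> continuous_on {g0<..} xI1 \<and> continuous_on {g0<..} xI2 \<and>
     (\<forall>g>g0. F_tilde \<mu> nE (nI1 + nI2) (cluster_state nI1 nI2 (xE g) (xI1 g) (xI2 g)) g
               = 0\<^sub>v (1 + (nI1 + nI2)) \<and>
             xI1 g \<noteq> xI2 g) \<and>
     (xE \<longlongrightarrow> 0) (at_right g0) \<and> (xI1 \<longlongrightarrow> 0) (at_right g0) \<and> (xI2 \<longlongrightarrow> 0) (at_right g0)"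


subsection \<open>Consistency checks\<close>

lemma balance_eq:
  assumes "nI \<ge> 1"
  shows "real nE = balance nE nI * real nI"
proof -
  have "1 - exc_fraction nE nI = real nI / real (nE + nI)"
    using assms by (simp add: exc_fraction_def field_simps)
  then show ?thesis
    using assms by (simp add: balance_def exc_fraction_def)
qed

lemma H_tilde_carrier: "H_tilde \<mu> nE nI \<in> carrier_mat (1 + nI) (1 + nI)"
  unfolding H_tilde_def ones_mat_def K_mat_def by (intro four_block_carrier_mat) auto

lemma F_tilde_index:
  assumes "x \<in> carrier_vec (1 + nI)" "i < 1 + nI"
  shows "F_tilde \<mu> nE nI x g $ i =
    - x $ i + (\<Sum>k\<in>{0..<1 + nI}. H_tilde \<mu> nE nI $$ (i, k) * tanh (g * x $ k)) / sqrt (real (nE + nI))"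
  using assms H_tilde_carrier[of \<mu> nE nI]
  by (simp add: F_tilde_def scalar_prod_def map_vec_def)

text \<open>\<open>DF_tilde\<close> is the matrix of partial derivatives of \<open>F_tilde\<close>.\<close>

lemma DF_tilde_partial_derivative:
  assumes x: "x \<in> carrier_vec (1 + nI)" and i: "i < 1 + nI" and j: "j < 1 + nI"
  shows "((\<lambda>t. F_tilde \<mu> nE nI (vec (1 + nI) (\<lambda>k. if k = j then t else x $ k)) g $ i)
            has_real_derivative DF_tilde \<mu> nE nI x g $$ (i, j)) (at (x $ j))"
proof -
  let ?H = "H_tilde \<mu> nE nI" and ?s = "sqrt (real (nE + nI))"
  let ?u = "\<lambda>t k. if k = j then t else x $ k"
  have tanh': "1 - (tanh y)\<^sup>2 = (sech y)\<^sup>2" for y :: real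
  proof -
    have "(sinh y)\<^sup>2 = (cosh y)\<^sup>2 - 1"
      by (simp add: cosh_square_eq)
    then show ?thesis
      using cosh_real_pos[of y] by (simp add: tanh_def sech_def power_divide diff_divide_distrib)
  qed
  have eq: "F_tilde \<mu> nE nI (vec (1 + nI) (?u t)) g $ i =
      - ?u t i + (\<Sum>k\<in>{0..<1 + nI}. ?H $$ (i, k) * tanh (g * ?u t k)) / ?s" for t
    using i by (subst F_tilde_index) (auto intro!: sum.cong arg_cong2[where f = "(/)"])
  have d: "((\<lambda>t. ?H $$ (i, k) * tanh (g * ?u t k)) has_real_derivative
       (if k = j then ?H $$ (i, k) * (g * (sech (g * x $ j))\<^sup>2) else 0)) (at (x $ j))" for k
    by (cases "k = j") (auto intro!: derivative_eq_intros simp: tanh')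
  have d0: "((\<lambda>t. - ?u t i) has_real_derivative (if i = j then -1 else 0)) (at (x $ j))"
    by (cases "i = j") (auto intro!: derivative_eq_intros)
  have "((\<lambda>t. - ?u t i + (\<Sum>k\<in>{0..<1 + nI}. ?H $$ (i, k) * tanh (g * ?u t k)) / ?s)
      has_real_derivative
      (if i = j then -1 else 0) +
      (\<Sum>k\<in>{0..<1 + nI}. if k = j then ?H $$ (i, k) * (g * (sech (g * x $ j))\<^sup>2) else 0) / ?s) (at (x $ j))"
    by (intro DERIV_add d0 DERIV_cdivide DERIV_sum d)
  also have "(if i = j then -1 else 0) +
      (\<Sum>k\<in>{0..<1 + nI}. if k = j then ?H $$ (i, k) * (g * (sech (g * x $ j))\<^sup>2) else 0) / ?s
      = DF_tilde \<mu> nE nI x g $$ (i, j)"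
  proof -
    have "(?H * mat_diag (1 + nI) (\<lambda>i. (sech (g * x $ i))\<^sup>2)) $$ (i, j)
        = ?H $$ (i, j) * (sech (g * x $ j))\<^sup>2"
      using i j by (subst mat_diag_mult_right[OF H_tilde_carrier]) auto
    then show ?thesis
      using i j H_tilde_carrier[of \<mu> nE nI]
      by (simp add: DF_tilde_def mat_diag_def)
  qed
  finally show ?thesis
    unfolding eq .
qed

lemma cluster_state_index:
  assumes "k < 1 + (nI1 + nI2)"
  shows "cluster_state nI1 nI2 xE xI1 xI2 $ k = (if k = 0 then xE else if k \<le> nI1 then xI1 else xI2)"
  using assms unfolding cluster_state_def vec_of_list_index by (auto simp: nth_Cons' nth_append)

lemma cluster_state_carrier: "cluster_state nI1 nI2 xE xI1 xI2 \<in> carrier_vec (1 + (nI1 + nI2))"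
  unfolding cluster_state_def by (rule carrier_vecI) simp

lemma cluster_sum:
  fixes h :: "nat \<Rightarrow> real"
  shows "(\<Sum>k\<in>{0..<1 + (nI1 + nI2)}. h k) = h 0 + (\<Sum>k\<in>{1..nI1}. h k) + (\<Sum>k\<in>{nI1 + 1..nI1 + nI2}. h k)"
proof -
  have eq: "{0..<1 + (nI1 + nI2)} = insert 0 ({1..nI1} \<union> {nI1 + 1..nI1 + nI2})"
    by auto
  have "sum h (insert 0 ({1..nI1} \<union> {nI1 + 1..nI1 + nI2})) =
      h 0 + sum h ({1..nI1} \<union> {nI1 + 1..nI1 + nI2})"
    by (rule sum.insert) auto
  also have "sum h ({1..nI1} \<union> {nI1 + 1..nI1 + nI2}) =
      sum h {1..nI1} + sum h {nI1 + 1..nI1 + nI2}"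
    by (rule sum.union_disjoint) auto
  finally show ?thesis
    unfolding eq by (simp only: add.assoc)
qed

lemma cluster_equilibrium:
  assumes n: "nI1 \<ge> 1" "nI2 \<ge> 1"
    and eq: "F_tilde \<mu> nE (nI1 + nI2) (cluster_state nI1 nI2 xE xI1 xI2) g = 0\<^sub>v (1 + (nI1 + nI2))"
  defines "\<alpha> \<equiv> balance nE (nI1 + nI2)" and "s \<equiv> \<mu> / sqrt (real (nE + (nI1 + nI2)))"
  defines "K \<equiv> s * (real nE * tanh (g * xE) - \<alpha> * (real nI1 * tanh (g * xI1) + real nI2 * tanh (g * xI2)))"
  shows "xE + s * tanh (g * xE) = K"
    and "xI1 - \<alpha> * s * tanh (g * xI1) = K"
    and "xI2 - \<alpha> * s * tanh (g * xI2) = K"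
proof -
  let ?nI = "nI1 + nI2"
  let ?x = "cluster_state nI1 nI2 xE xI1 xI2"
  let ?H = "H_tilde \<mu> nE ?nI"
  let ?r = "sqrt (real (nE + ?nI))"
  define a where "a = tanh (g * xE)"
  define b where "b = tanh (g * xI1)"
  define c where "c = tanh (g * xI2)"
  let ?h = "\<lambda>i k. ?H $$ (i, k) * tanh (g * ?x $ k)"
  have H: "?H $$ (i, k) = (if i = 0 then if k = 0 then (real nE - 1) * \<mu> else - \<alpha> * \<mu>
      else if k = 0 then real nE * \<mu> else - \<alpha> * \<mu> * (if i = k then 0 else 1))"
    if "i < 1 + ?nI" "k < 1 + ?nI" for i k
    using that by (auto simp: H_tilde_def ones_mat_def K_mat_def \<alpha>_def)
  have row: "?x $ i = ((\<Sum>k\<in>{0..<1 + ?nI}. ?h i k)) / ?r" if i: "i < 1 + ?nI" for i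
  proof -
    have "F_tilde \<mu> nE ?nI ?x g $ i = 0"
      using eq i by simp
    then show ?thesis
      using F_tilde_index[OF cluster_state_carrier i, of \<mu> nE xE xI1 xI2 g] by simp
  qed
  have S1: "(\<Sum>k\<in>{1..nI1}. ?h i k) = - \<alpha> * \<mu> * (real nI1 - (if i \<in> {1..nI1} then 1 else 0)) * b"
    if i: "i < 1 + ?nI" for i
  proof -
    have "(\<Sum>k\<in>{1..nI1}. ?h i k) = (\<Sum>k\<in>{1..nI1}. - \<alpha> * \<mu> * b - (if i = k then - \<alpha> * \<mu> * b else 0))"
      using i by (intro sum.cong) (auto simp: H cluster_state_index b_def)
    also have "\<dots> = - \<alpha> * \<mu> * (real nI1 - (if i \<in> {1..nI1} then 1 else 0)) * b"
      by (simp add: sum_subtractf algebra_simps)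
    finally show ?thesis .
  qed
  have S2: "(\<Sum>k\<in>{nI1 + 1..?nI}. ?h i k) =
      - \<alpha> * \<mu> * (real nI2 - (if i \<in> {nI1 + 1..?nI} then 1 else 0)) * c"
    if i: "i < 1 + ?nI" for i
  proof -
    have "(\<Sum>k\<in>{nI1 + 1..?nI}. ?h i k) =
        (\<Sum>k\<in>{nI1 + 1..?nI}. - \<alpha> * \<mu> * c - (if i = k then - \<alpha> * \<mu> * c else 0))"
      using i by (intro sum.cong) (auto simp: H cluster_state_index c_def)
    also have "\<dots> = - \<alpha> * \<mu> * (real nI2 - (if i \<in> {nI1 + 1..?nI} then 1 else 0)) * c"
      by (simp add: sum_subtractf algebra_simps)
    finally show ?thesis .
  qed
  have S: "?x $ i = (?h i 0
      - \<alpha> * \<mu> * (real nI1 - (if i \<in> {1..nI1} then 1 else 0)) * b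
      - \<alpha> * \<mu> * (real nI2 - (if i \<in> {nI1 + 1..?nI} then 1 else 0)) * c) / ?r"
    if i: "i < 1 + ?nI" for i
    using row[OF i] unfolding cluster_sum S1[OF i] S2[OF i] by simp
  have K: "K = s * (real nE * a - \<alpha> * (real nI1 * b + real nI2 * c))"
    by (simp add: K_def a_def b_def c_def)
  have sdiv: "(\<mu> * z) / ?r = s * z" for z
    by (simp add: s_def)
  have "?h 0 0 = (real nE - 1) * \<mu> * a"
    using n by (simp add: H cluster_state_index a_def)
  then have "?x $ 0 = (\<mu> * ((real nE - 1) * a - \<alpha> * (real nI1 * b + real nI2 * c))) / ?r"
    using n by (subst S) (auto intro!: arg_cong2[where f = "(/)"] simp: algebra_simps)
  then have "xE = (\<mu> * ((real nE - 1) * a - \<alpha> * (real nI1 * b + real nI2 * c))) / ?r"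
    using n by (subst (asm) cluster_state_index) auto
  then show "xE + s * tanh (g * xE) = K"
    unfolding sdiv K a_def[symmetric] by (simp add: algebra_simps)
  have "?h 1 0 = real nE * \<mu> * a"
    using n by (simp add: H cluster_state_index a_def)
  then have "?x $ 1 = (\<mu> * (real nE * a - \<alpha> * ((real nI1 - 1) * b + real nI2 * c))) / ?r"
    using n by (subst S) (auto intro!: arg_cong2[where f = "(/)"] simp: algebra_simps)
  then have "xI1 = (\<mu> * (real nE * a - \<alpha> * ((real nI1 - 1) * b + real nI2 * c))) / ?r"
    using n by (subst (asm) cluster_state_index) auto
  then show "xI1 - \<alpha> * s * tanh (g * xI1) = K"
    unfolding sdiv K b_def[symmetric] by (simp add: algebra_simps)
  have "?h (nI1 + 1) 0 = real nE * \<mu> * a"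
    using n by (simp add: H cluster_state_index a_def)
  then have "?x $ (nI1 + 1) = (\<mu> * (real nE * a - \<alpha> * (real nI1 * b + (real nI2 - 1) * c))) / ?r"
    using n by (subst S) (auto intro!: arg_cong2[where f = "(/)"] simp: algebra_simps)
  then have "xI2 = (\<mu> * (real nE * a - \<alpha> * (real nI1 * b + (real nI2 - 1) * c))) / ?r"
    using n by (subst (asm) cluster_state_index) auto
  then show "xI2 - \<alpha> * s * tanh (g * xI2) = K"
    unfolding sdiv K c_def[symmetric] by (simp add: algebra_simps)
qed

lemma unique_positive_root:
  fixes g w K x y :: real
  assumes g: "g > 0" and w: "w > 0" and K: "K > 0" and x: "0 < x" and xy: "x < y"
    and fx: "x - w * tanh (g * x) = K" and fy: "y - w * tanh (g * y) = K"
  shows False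
proof -
  let ?f = "\<lambda>t. t - w * tanh (g * t)"
  let ?f' = "\<lambda>t. 1 - w * g * (1 - (tanh (g * t))\<^sup>2)"
  have d: "(?f has_real_derivative ?f' t) (at t)" for t
    by (auto intro!: derivative_eq_intros)
  obtain p where p: "0 < p" "p < x" "?f x - ?f 0 = (x - 0) * ?f' p"
    using MVT2[of 0 x ?f ?f'] x d by blast
  obtain q where q: "x < q" "q < y" "?f y - ?f x = (y - x) * ?f' q"
    using MVT2[of x y ?f ?f'] xy d by blast
  have "?f' p > 0"
  proof -
    have "x * ?f' p > 0"
      using p(3) fx K by simp
    then show ?thesis
      using x by (metis zero_less_mult_pos)
  qed
  moreover have "?f' q = 0"
    using q(3) fx fy xy by simp
  moreover have "?f' p \<le> ?f' q"
  proof -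
    have "g * p \<le> g * q"
      using p q g by simp
    then have "tanh (g * p) \<le> tanh (g * q)"
      by simp
    moreover have "0 \<le> tanh (g * p)"
      using p g by simp
    ultimately have "(tanh (g * p))\<^sup>2 \<le> (tanh (g * q))\<^sup>2"
      by (rule power_mono)
    then have "w * g * (1 - (tanh (g * q))\<^sup>2) \<le> w * g * (1 - (tanh (g * p))\<^sup>2)"
      using w g by (intro mult_left_mono) auto
    then show ?thesis
      by simp
  qed
  ultimately show False
    by linarith
qed

lemma not_both_nonneg:
  fixes g s \<alpha> K u x y :: real
  assumes g: "g > 0" and s: "s > 0" and \<alpha>: "\<alpha> > 0" and u: "u \<ge> 0" and n: "m \<ge> 1" "n \<ge> 1"
    and K: "K = s * (u * tanh (g * z) - \<alpha> * (m * tanh (g * x) + n * tanh (g * y)))"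
    and fz: "z + s * tanh (g * z) = K"
    and fx: "x - \<alpha> * s * tanh (g * x) = K" and fy: "y - \<alpha> * s * tanh (g * y) = K"
    and xy: "x \<noteq> y"
  shows "\<not> (0 \<le> x \<and> 0 \<le> y)"
proof
  assume nn: "0 \<le> x \<and> 0 \<le> y"
  have w: "\<alpha> * s > 0"
    using \<alpha> s by simp
  show False
  proof (cases "K > 0")
    case True
    have "x \<noteq> 0" "y \<noteq> 0"
      using fx fy True by auto
    then show False
      using unique_positive_root[OF g w True, of x y] unique_positive_root[OF g w True, of y x]
        fx fy xy nn by force
  next
    case False
    have b: "0 \<le> tanh (g * x)" and c: "0 \<le> tanh (g * y)"
      using nn g by auto
    have "z \<le> 0"
    proof (rule ccontr)
      assume "\<not> z \<le> 0"
      then have "s * tanh (g * z) > 0"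
        using s g by simp
      then show False
        using fz False \<open>\<not> z \<le> 0\<close> by linarith
    qed
    then have a: "tanh (g * z) \<le> 0"
      using g by (simp add: mult_nonneg_nonpos)
    have "s * (u * tanh (g * z)) \<le> 0"
      using s u a by (simp add: mult_nonneg_nonpos)
    moreover have "\<alpha> * s * (tanh (g * x) + tanh (g * y)) \<le> \<alpha> * s * (m * tanh (g * x) + n * tanh (g * y))"
      using w n b c mult_right_mono[OF n(1) b] mult_right_mono[OF n(2) c]
      by (intro mult_left_mono) auto
    ultimately have "K \<le> - (\<alpha> * s * (tanh (g * x) + tanh (g * y)))"
      unfolding K by (simp add: algebra_simps)
    then have le: "x + \<alpha> * s * tanh (g * y) \<le> 0" "y + \<alpha> * s * tanh (g * x) \<le> 0"
      using fx fy by (simp_all add: algebra_simps)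
    have "0 \<le> \<alpha> * s * tanh (g * y)" "0 \<le> \<alpha> * s * tanh (g * x)"
      using w b c by simp_all
    then have "x = 0" "y = 0"
      using le nn by linarith+
    then show False
      using xy by simp
  qed
qed

lemma I1_I2_branch_opposite_signs:
  assumes "nE \<ge> 1" "nI1 \<ge> 1" "nI2 \<ge> 1" "\<mu> > 0"
    and br: "I1_I2_branch \<mu> nE nI1 nI2 (g_crit \<mu> nE (nI1 + nI2)) xE xI1 xI2"
    and g: "g > g_crit \<mu> nE (nI1 + nI2)"
  shows "xI1 g * xI2 g < 0"
proof -
  let ?nI = "nI1 + nI2"
  define \<alpha> where "\<alpha> = balance nE ?nI"
  define s where "s = \<mu> / sqrt (real (nE + ?nI))"
  have "\<alpha> * real ?nI > 0"
    using balance_eq[of ?nI nE] assms by (simp add: \<alpha>_def)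
  then have \<alpha>: "\<alpha> > 0"
    using assms by (simp add: zero_less_mult_iff)
  have s: "s > 0"
    using assms by (simp add: s_def)
  have "g_crit \<mu> nE ?nI > 0"
    using assms \<alpha> by (simp add: g_crit_def \<alpha>_def)
  then have g0: "g > 0"
    using g by simp
  have eq: "F_tilde \<mu> nE ?nI (cluster_state nI1 nI2 (xE g) (xI1 g) (xI2 g)) g = 0\<^sub>v (1 + ?nI)"
    and ne: "xI1 g \<noteq> xI2 g"
    using br g by (auto simp: I1_I2_branch_def)
  define K where "K = s * (real nE * tanh (g * xE g) -
    \<alpha> * (real nI1 * tanh (g * xI1 g) + real nI2 * tanh (g * xI2 g)))"
  have fz: "xE g + s * tanh (g * xE g) = K"
    and fx: "xI1 g - \<alpha> * s * tanh (g * xI1 g) = K"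
    and fy: "xI2 g - \<alpha> * s * tanh (g * xI2 g) = K"
    using cluster_equilibrium[OF assms(2,3) eq] by (simp_all add: K_def \<alpha>_def s_def)
  have n: "real nI1 \<ge> 1" "real nI2 \<ge> 1"
    using assms by auto
  have 1: "\<not> (0 \<le> xI1 g \<and> 0 \<le> xI2 g)"
    using not_both_nonneg[OF g0 s \<alpha> _ n K_def fz fx fy ne] by simp
  have K': "- K = s * (real nE * tanh (g * - xE g) -
    \<alpha> * (real nI1 * tanh (g * - xI1 g) + real nI2 * tanh (g * - xI2 g)))"
    unfolding K_def by (simp add: algebra_simps)
  have 2: "\<not> (0 \<le> - xI1 g \<and> 0 \<le> - xI2 g)"
    by (rule not_both_nonneg[OF g0 s \<alpha> _ n K']) (use fz fx fy ne in auto)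
  from 1 2 show ?thesis
    by (auto simp: mult_less_0_iff)
qed

end

(* The inhibitory block of the coupling matrix has zero diagonal, so the trace of the Jacobian is
   g s (n_E - 1) sech^2(g x_E) - (1 + n_I) with s = mu / sqrt N.  The opposite signs of x_I1 and
   x_I2 confine tanh(g x_E) to the interval [-1 + 1/n_I, 1 - 1/n_I], uniformly in g; hence sech^2(g x_E) is
   bounded below and the trace grows linearly in g.  A matrix with positive trace has an
   eigenvalue with positive real part. *)
theory Submission
  imports Defs "Jordan_Normal_Form.Schur_Decomposition"
begin

lemma sum_diag_mult_comm:
  fixes A B :: "'a :: comm_semiring_0 mat"
  assumes "A \<in> carrier_mat n m" "B \<in> carrier_mat m n"
  shows "(\<Sum>i<n. (A * B) $$ (i, i)) = (\<Sum>j<m. (B * A) $$ (j, j))"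
proof -
  have "(\<Sum>i<n. (A * B) $$ (i, i)) = (\<Sum>i<n. \<Sum>j<m. A $$ (i, j) * B $$ (j, i))"
    using assms by (auto simp: scalar_prod_def atLeast0LessThan intro!: sum.cong)
  also have "\<dots> = (\<Sum>j<m. \<Sum>i<n. B $$ (j, i) * A $$ (i, j))"
    by (subst sum.swap) (simp add: mult.commute)
  also have "\<dots> = (\<Sum>j<m. (B * A) $$ (j, j))"
    using assms by (auto simp: scalar_prod_def atLeast0LessThan intro!: sum.cong)
  finally show ?thesis .
qed

text \<open>With A = P B Q, cyclicity of the trace moves Q to the front, where Q P = 1
  cancels.\<close>

lemma sum_diag_similar:
  fixes A B :: "'a :: comm_ring_1 mat"
  assumes "A \<in> carrier_mat n n" and "similar_mat A B"
  shows "(\<Sum>i<n. A $$ (i, i)) = (\<Sum>i<n. B $$ (i, i))"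
proof -
  obtain k P Q where c: "{A, B, P, Q} \<subseteq> carrier_mat k k" and QP: "Q * P = 1\<^sub>m k"
    and A: "A = P * B * Q"
    using similar_matD[OF assms(2)] by blast
  have "k = n"
    using c assms(1) by auto
  with c have c: "B \<in> carrier_mat n n" "P \<in> carrier_mat n n" "Q \<in> carrier_mat n n"
    by auto
  have "(\<Sum>i<n. A $$ (i, i)) = (\<Sum>i<n. (Q * (P * B)) $$ (i, i))"
    unfolding A by (rule sum_diag_mult_comm) (use c in auto)
  also have "Q * (P * B) = B"
    using c QP \<open>k = n\<close> assoc_mult_mat[OF c(3,2,1)] by simp
  finally show ?thesis .
qed

text \<open>Triangularization over the complex numbers preserves the trace and puts the eigenvalues
  on the diagonal. Real parts that are all nonpositive could not have a positive sum.\<close>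

lemma eigenvalue_Re_pos_if_trace_pos:
  fixes A :: "complex mat"
  assumes A: "A \<in> carrier_mat n n" and tr: "Re (\<Sum>i<n. A $$ (i, i)) > 0"
  shows "\<exists>ev. eigenvalue A ev \<and> Re ev > 0"
proof -
  \<comment> \<open>The characteristic polynomial splits over the complex numbers, which is what the
    Schur decomposition requires.\<close>
  obtain es where "char_poly A = (\<Prod>a\<leftarrow>es. [:- a, 1:])"
    using char_poly_factorized[OF A] by blast
  then obtain B where B: "B \<in> carrier_mat n n" "upper_triangular B" and sim: "similar_mat A B"
    using schur_decomposition_exists[OF A] by blast
  have "(\<Sum>i<n. Re (B $$ (i, i))) > 0"
    using tr sum_diag_similar[OF A sim] by simp
  then obtain i where i: "i < n" "Re (B $$ (i, i)) > 0"
    using sum_nonpos[of "{..<n}" "\<lambda>i. Re (B $$ (i, i))"] by force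
  have "char_poly A = (\<Prod>a\<leftarrow>diag_mat B. [:- a, 1:])"
    using char_poly_similar[OF sim] char_poly_upper_triangular[OF B] by simp
  moreover have "B $$ (i, i) \<in> set (diag_mat B)"
    using i B by (auto simp: diag_mat_def)
  ultimately have "poly (char_poly A) (B $$ (i, i)) = 0"
    by (auto simp: poly_prod_list prod_list_zero_iff)
  then show ?thesis
    using i eigenvalue_root_char_poly[OF A] by blast
qed

lemma sum_diag_DF_tilde:
  "(\<Sum>i<1 + nI. DF_tilde \<mu> nE nI x g $$ (i, i)) =
    g / sqrt (real (nE + nI)) * ((real nE - 1) * \<mu>) * (sech (g * x $ 0))\<^sup>2 - (1 + real nI)"
proof -
  have d: "DF_tilde \<mu> nE nI x g $$ (i, i) =
      g / sqrt (real (nE + nI)) * (H_tilde \<mu> nE nI $$ (i, i) * (sech (g * x $ i))\<^sup>2) - 1"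
    if "i < 1 + nI" for i
  proof -
    have "(H_tilde \<mu> nE nI * mat_diag (1 + nI) (\<lambda>i. (sech (g * x $ i))\<^sup>2)) $$ (i, i) =
        H_tilde \<mu> nE nI $$ (i, i) * (sech (g * x $ i))\<^sup>2"
      using that by (subst mat_diag_mult_right[OF H_tilde_carrier]) auto
    then show ?thesis
      using that H_tilde_carrier[of \<mu> nE nI] by (simp add: DF_tilde_def mat_diag_def)
  qed
  have H0: "H_tilde \<mu> nE nI $$ (0, 0) = (real nE - 1) * \<mu>"
    by (simp add: H_tilde_def ones_mat_def K_mat_def)
  have HS: "H_tilde \<mu> nE nI $$ (Suc i, Suc i) = 0" if "i < nI" for i
    using that by (simp add: H_tilde_def ones_mat_def K_mat_def)
  \<comment> \<open>Index 0 is the excitatory variable; every later diagonal entry is just the -1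
    from the subtracted identity.\<close>
  have "(\<Sum>i<1 + nI. DF_tilde \<mu> nE nI x g $$ (i, i)) =
      DF_tilde \<mu> nE nI x g $$ (0, 0) + (\<Sum>i<nI. DF_tilde \<mu> nE nI x g $$ (Suc i, Suc i))"
    unfolding plus_1_eq_Suc sum.lessThan_Suc_shift ..
  also have "(\<Sum>i<nI. DF_tilde \<mu> nE nI x g $$ (Suc i, Suc i)) = (\<Sum>i<nI. - 1)"
    by (intro sum.cong) (auto simp: d HS)
  finally show ?thesis
    by (simp add: d H0)
qed

text \<open>Here a, b, c stand for the tanh values of the E, I1 and I2 clusters of an equilibrium,
  and k + b and k + c carry the signs of the two inhibitory activities. Solving for a gives (m + n)
  a = k + m b + n c, which the sign conditions keep away from m + n and -(m + n).\<close>

lemma abs_exc_activity_le: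
  fixes a b c k m n :: real
  assumes mn: "m \<ge> 1" "n \<ge> 1" and b: "0 \<le> b" "b \<le> 1" and c: "- 1 \<le> c" "c \<le> 0"
    and k: "k = m * (a - b) + n * (a - c)" and "k + b > 0" and "k + c < 0"
  shows "\<bar>a\<bar> \<le> 1 - 1 / (m + n)"
proof -
  \<comment> \<open>From above, k + n c \<le> k + c < 0 leaves m b \<le> m \<le> m + n - 1. From
    below, k + m b \<ge> k + b > 0 leaves n c \<ge> -n \<ge> -(m + n - 1).\<close>
  have "m * b \<le> m" "- n \<le> n * c"
    using mn b c mult_left_le[of b m] mult_left_mono[of "- 1" c n] by auto
  moreover have "b \<le> m * b" "n * c \<le> c"
    using mn b c mult_right_mono[of 1 m b] mult_right_mono_neg[of 1 n c] by auto
  moreover have "(m + n) * a = k + m * b + n * c" "(m + n) * (- a) = - (k + m * b + n * c)"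
    by (simp_all add: k algebra_simps)
  ultimately have "(m + n) * a \<le> m + n - 1" "(m + n) * (- a) \<le> m + n - 1"
    using assms(8,9) mn by linarith+
  moreover have "1 - 1 / (m + n) = (m + n - 1) / (m + n)"
    using mn by (simp add: field_simps)
  ultimately show ?thesis
    using mn by (simp add: abs_le_iff pos_le_divide_eq pos_divide_le_eq mult.commute minus_le_iff)
qed

text \<open>Since sech^2 = 1 - tanh^2 and |tanh| < 1, the square may be replaced by |tanh|
  itself.\<close>

lemma sech_square_ge:
  fixes y :: real
  assumes "\<bar>tanh y\<bar> \<le> 1 - d"
  shows "d \<le> (sech y)\<^sup>2"
proof -
  have "(sech y)\<^sup>2 = 1 - (tanh y)\<^sup>2"
    using cosh_real_pos[of y]
    by (simp add: sech_def tanh_def power_divide sinh_square_eq diff_divide_distrib)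
  moreover have "(tanh y)\<^sup>2 \<le> \<bar>tanh y\<bar>"
    using tanh_real_bounds[of y] mult_left_le[of "\<bar>tanh y\<bar>" "\<bar>tanh y\<bar>"]
    by (simp add: power2_eq_square abs_le_iff less_imp_le flip: abs_mult)
  ultimately show ?thesis
    using assms by linarith
qed

text \<open>The inhibitory activities straddle zero, so the excitatory cluster cannot saturate. The
  bound is independent of g, so it can be multiplied by the growing factor g in the trace.\<close>

lemma branch_sech_exc_ge:
  assumes n: "nE \<ge> 1" "nI1 \<ge> 1" "nI2 \<ge> 1" and \<mu>: "\<mu> > 0"
    and br: "I1_I2_branch \<mu> nE nI1 nI2 (g_crit \<mu> nE (nI1 + nI2)) xE xI1 xI2"
    and g: "g > g_crit \<mu> nE (nI1 + nI2)" and g0: "g > 0"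
  shows "1 / real (nI1 + nI2) \<le> (sech (g * xE g))\<^sup>2"
proof -
  let ?nI = "nI1 + nI2"
  define \<alpha> where "\<alpha> = balance nE ?nI"
  define s where "s = \<mu> / sqrt (real (nE + ?nI))"
  define a where "a = tanh (g * xE g)"
  define b where "b = tanh (g * xI1 g)"
  define c where "c = tanh (g * xI2 g)"
  \<comment> \<open>This is the common right-hand side of the cluster equations divided by \<alpha>
    s; the balance \<open>nE\<close> = \<alpha> (\<open>nI1\<close> + \<open>nI2\<close>)
    distributes the excitatory term over the two inhibitory clusters.\<close>
  define k where "k = real nI1 * (a - b) + real nI2 * (a - c)"
  have nE: "real nE = \<alpha> * real ?nI"
    using balance_eq[of ?nI nE] n by (simp add: \<alpha>_def)
  then have "\<alpha> * real ?nI > 0"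
    using n by linarith
  then have \<alpha>: "\<alpha> > 0"
    by (simp add: zero_less_mult_iff)
  define w where "w = \<alpha> * s"
  have w: "w > 0"
    using \<alpha> \<mu> n by (simp add: w_def s_def)
  have eq: "F_tilde \<mu> nE ?nI (cluster_state nI1 nI2 (xE g) (xI1 g) (xI2 g)) g = 0\<^sub>v (1 + ?nI)"
    using br g by (auto simp: I1_I2_branch_def)
  have "s * (real nE * a - \<alpha> * (real nI1 * b + real nI2 * c)) = w * k"
    by (simp add: nE k_def w_def algebra_simps)
  then have x: "xI1 g = w * (k + b)" "xI2 g = w * (k + c)"
    using cluster_equilibrium(2,3)[OF n(2,3) eq, folded \<alpha>_def s_def, folded a_def b_def c_def w_def]
    by (simp_all add: algebra_simps)
  have bc: "- 1 \<le> b" "b \<le> 1" "- 1 \<le> c" "c \<le> 1"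
    using tanh_real_bounds[of "g * xI1 g"] tanh_real_bounds[of "g * xI2 g"]
    by (auto simp: b_def c_def)
  have m: "real nI1 \<ge> 1" "real nI2 \<ge> 1"
    using n by auto
  have sgn: "0 < xI1 g \<longleftrightarrow> 0 < k + b" "xI1 g < 0 \<longleftrightarrow> k + b < 0"
      "0 < xI2 g \<longleftrightarrow> 0 < k + c" "xI2 g < 0 \<longleftrightarrow> k + c < 0"
    unfolding x using w by (simp_all add: zero_less_mult_iff mult_less_0_iff)
  \<comment> \<open>Either cluster may be the positive one. The bound is symmetric, so the second
    case exchanges the roles of I1 and I2.\<close>
  consider "xI1 g > 0" "xI2 g < 0" | "xI1 g < 0" "xI2 g > 0"
    using I1_I2_branch_opposite_signs[OF n \<mu> br g] by (auto simp: mult_less_0_iff)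
  then have "\<bar>a\<bar> \<le> 1 - 1 / (real nI1 + real nI2)"
  proof cases
    case 1
    then have "0 \<le> b" "c \<le> 0" "k + b > 0" "k + c < 0"
      unfolding sgn[symmetric] using g0 by (simp_all add: b_def c_def mult_nonneg_nonpos)
    then show ?thesis
      using abs_exc_activity_le[OF m _ _ _ _ k_def] bc by blast
  next
    case 2
    then have "b \<le> 0" "0 \<le> c" "k + c > 0" "k + b < 0"
      unfolding sgn[symmetric] using g0 by (simp_all add: b_def c_def mult_nonneg_nonpos)
    moreover have "k = real nI2 * (a - c) + real nI1 * (a - b)"
      by (simp add: k_def)
    ultimately have "\<bar>a\<bar> \<le> 1 - 1 / (real nI2 + real nI1)"
      using abs_exc_activity_le[OF m(2,1)] bc by blast
    then show ?thesis
      by (simp add: add.commute)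
  qed
  then show ?thesis
    using sech_square_ge[of "g * xE g" "1 / real ?nI"] by (simp add: a_def)
qed

theorem mainTheorem5:
  fixes nE nI nI1 nI2 :: nat and \<mu> :: real and xE xI1 xI2 :: "real \<Rightarrow> real"
  assumes "nE \<ge> 1" and "nI \<ge> 1" and "\<mu> > 0"
    and "balance nE nI > 1"
    and "nI1 \<ge> nI2" and "nI2 \<ge> 1" and "nI1 + nI2 = nI"
    and "I1_I2_branch \<mu> nE nI1 nI2 (g_crit \<mu> nE nI) xE xI1 xI2"
  shows "\<forall>\<^sub>F g in at_top.
    \<exists>ev. eigenvalue (map_mat complex_of_real
            (DF_tilde \<mu> nE nI (cluster_state nI1 nI2 (xE g) (xI1 g) (xI2 g)) g)) ev \<and> Re ev > 0"
proof -
  define s where "s = \<mu> / sqrt (real (nE + nI))"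
  have s: "s > 0"
    using assms by (simp add: s_def)
  \<comment> \<open>\<alpha> > 1 forces \<open>nE\<close> > \<open>nI\<close> \<ge> 1, so the
    coefficient \<open>nE\<close> - 1 of the growing trace term is at least 1.\<close>
  have "real nI < balance nE nI * real nI"
    using assms by simp
  then have "real nI < real nE"
    using balance_eq[of nI nE] assms by simp
  then have nE: "real nE - 1 \<ge> 1"
    using assms by linarith
  \<comment> \<open>The last threshold makes g s / \<open>nI\<close>, a lower bound for the positive
    trace term, exceed the 1 + \<open>nI\<close> subtracted by the identity.\<close>
  have "\<forall>\<^sub>F g in at_top. g > g_crit \<mu> nE nI \<and> g > 0 \<and> g > (1 + real nI) * real nI / s"
    by (intro eventually_conj eventually_gt_at_top)
  then show ?thesis
  proof eventually_elim
    case (elim g)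
    let ?x = "cluster_state nI1 nI2 (xE g) (xI1 g) (xI2 g)"
    let ?D = "DF_tilde \<mu> nE nI ?x g"
    have "1 / real nI \<le> (sech (g * xE g))\<^sup>2"
      using branch_sech_exc_ge[of nE nI1 nI2 \<mu> xE xI1 xI2 g] assms elim by simp
    then have "g * s * 1 * (1 / real nI) \<le> g * s * (real nE - 1) * (sech (g * xE g))\<^sup>2"
      using elim s nE by (intro mult_mono mult_nonneg_nonneg) auto
    moreover have "1 + real nI < g * s * 1 * (1 / real nI)"
      using elim s assms by (simp add: field_simps)
    moreover have "?x $ 0 = xE g"
      by (simp add: cluster_state_index)
    ultimately have tr: "(\<Sum>i<1 + nI. ?D $$ (i, i)) > 0"
      unfolding sum_diag_DF_tilde by (simp add: s_def mult_ac)
    have D: "?D \<in> carrier_mat (1 + nI) (1 + nI)"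
      using H_tilde_carrier[of \<mu> nE nI] by (auto simp: DF_tilde_def)
    have "Re (\<Sum>i<1 + nI. map_mat complex_of_real ?D $$ (i, i)) = (\<Sum>i<1 + nI. ?D $$ (i, i))"
      unfolding Re_sum using D by (intro sum.cong) auto
    then show ?case
      using eigenvalue_Re_pos_if_trace_pos[of "map_mat complex_of_real ?D" "1 + nI"] D tr by simp
  qed
qed

end
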